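(* Let $(\mathbb{A},\mathbb{HA})$ be any of the following pairs consisting of a class of algebras and its corresponding class of heterogeneous algebras: (tqBa, htqBa), (tqBa5, htqBa5), (IA1, hIA1), (IA2, hIA2), (IA3, hIA3), (pra, hpra). Then: 1. if $\mathbb{T}\in\mathbb{A}$, then $\mathbb{T}^+\in\mathbb{HA}$; 2. if $\mathbb{H}\in\mathbb{HA}$, then $\mathbb{H}_+\in\mathbb{A}$; 3. $\mathbb{T}\cong(\mathbb{T}^+)_+$ for every $\mathbb{T}\in\mathbb{A}$, and $\mathbb{H}\cong(\mathbb{H}_+)^+$ for every $\mathbb{H}\in\mathbb{HA}$.
   Context: **Algebras.** A De Morgan algebra is a bounded distributive lattice $(L,\lor,\land,\neg,\top,\bot)$ with an order-reversing involution $\neg$ (so $\neg\neg a=a$ and $\neg(a\lor b)=\neg a\land\neg b$). A topological quasi-Boolean algebra (tqBa) is $\mathbb{T}=(\mathbb{L},I)$ where $\mathbb{L}=(L,\lor,\land,\neg,\top,\bot)$ is a De Morgan algebra and for all $a,b\in L$: (T1) $I(a\land b)=Ia\land Ib$; (T2) $IIa=Ia$; (T3) $Ia\le a$; (T4) $I\top=\top$. Put $Ca:=\neg I\neg a$. Consider (T5) $CIa=Ia$; (T6) $Ia\lor\neg Ia=\top$; (T7) $Ia\lor Ib=I(a\lor b)$; (T8) $Ia\le Ib$ and $Ca\le Cb$ imply $a\le b$. A tqBa is: a tqBa5 if T5 holds; an IA1 if T5, T6 hold; an IA2 if T5, T7 hold; an IA3 if T5, T8 hold; a pre-rough algebra (pra)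 if T5, T6, T7, T8 hold. **Kernels.** For a tqBa $\mathbb{T}$ let $K_I=\{Ia\mid a\in L\}$, $K_C=\{Ca\mid a\in L\}$, ordered as subsets of $L$; $\iota:L\to K_I$, $a\mapsto Ia$; $\gamma:L\to K_C$, $a\mapsto Ca$; $e_I:K_I\hookrightarrow L$ and $e_C:K_C\hookrightarrow L$ the inclusions. The left kernel is $\mathbb{K}_I=(K_I,\cup,\cap,1_I,0_I)$ with $\alpha\cup\beta:=\iota(e_I(\alpha)\lor e_I(\beta))$, $\alpha\cap\beta:=\iota(e_I(\alpha)\land e_I(\beta))$, $1_I:=\iota(\top)$, $0_I:=\iota(\bot)$. The right kernel is $\mathbb{K}_C=(K_C,\sqcup,\sqcap,1_C,0_C)$ with $\xi\sqcup\chi:=\gamma(e_C(\xi)\lor e_C(\chi))$, $\xi\sqcap\chi:=\gamma(e_C(\xi)\land e_C(\chi))$, $1_C:=\gamma(\top)$, $0_C:=\gamma(\bot)$. If $\mathbb{T}$ is a tqBa5, also $\sim\alpha:=\iota(\neg e_I(\alpha))$ on $K_I$ and $-\xi:=\gamma(\neg e_C(\xi))$ on $K_C$; in this case the two kernels are identified (as $\mathbb{K}$), and so are $e_I$ and $e_C$ (as $e$). **Heterogeneous algebras.** A heterogeneous tqBa (htqBa) is a tuple $\mathbb{H}=(\mathbb{D},\mathbb{L}_I,\mathbb{L}_C,e_I,e_C,\iota,\gamma)$ such that: (H1) $\mathbb{D}=(D,\lor,\land,\neg,\top,\bot)$ is a De Morgan algebra; (H2) $\mathbb{L}_I=(L_I,\cup,\cap,0_I,1_I)$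 and $\mathbb{L}_C=(L_C,\sqcup,\sqcap,0_C,1_C)$ are bounded distributive lattices; (H3) $e_I:\mathbb{L}_I\hookrightarrow\mathbb{D}$ and $e_C:\mathbb{L}_C\hookrightarrow\mathbb{D}$ are homomorphisms of bounded lattices; (H4) $\iota:D\to L_I$ and $\gamma:D\to L_C$ satisfy $\iota(a\land b)=\iota(a)\cap\iota(b)$, $\iota(\top)=1_I$, $\iota(\bot)=0_I$, $\gamma(a\lor b)=\gamma(a)\sqcup\gamma(b)$, $\gamma(\top)=1_C$, $\gamma(\bot)=0_C$; (H5) $e_I\dashv\iota$ (i.e. $e_I(\alpha)\le a$ iff $\alpha\le\iota(a)$), $\gamma\dashv e_C$ (i.e. $\gamma(a)\le\xi$ iff $a\le e_C(\xi)$), $\iota(e_I(\alpha))=\alpha$, $\gamma(e_C(\xi))=\xi$; (H6) $e_C(\gamma(a))=\neg e_I(\iota(\neg a))$. Further conditions: (H7) $\mathbb{L}_I=\mathbb{L}_C=\mathbb{L}$ is a De Morgan algebra and $e_I=e_C=e$ is a De Morgan homomorphism; (H8) $\mathbb{L}$ is a Boolean algebra; (H9) $\iota(a\lor b)=\iota(a)\cup\iota(b)$; (H10) $\iota(a)\le\iota(b)$ and $\gamma(a)\le\gamma(b)$ imply $a\le b$. An htqBa is an htqBa5 if H7 holds; hIA1 if H7, H8; hIA2 if H7, H9; hIA3 if H7, H10; hpra if H7, H8, H9, H10. **The two constructions.** For a tqBa $\mathbb{T}=(\mathbb{L},I)$, $\mathbb{T}^+:=(\mathbb{L},\mathbb{K}_I,\mathbb{K}_C,e_I,e_C,\iota,\gamma)$,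 where $\mathbb{K}_I$ and $\mathbb{K}_C$ are the left and right kernels of $\mathbb{T}$, $e_I:K_I\hookrightarrow L$ and $e_C:K_C\hookrightarrow L$ are the inclusions, and $\iota:L\to K_I$, $\gamma:L\to K_C$ are given by $\iota(a)=Ia$, $\gamma(a)=Ca$ (for a tqBa5: $\mathbb{T}^+=(\mathbb{L},\mathbb{K},e,\iota,\gamma)$ with the kernels and the embeddings identified). For an htqBa $\mathbb{H}$, $\mathbb{H}_+:=(\mathbb{D},I,C)$ with $I(a):=e_I(\iota(a))$ and $C(a):=e_C(\gamma(a))$; it is regarded as an algebra $(\mathbb{D},I)$ in which $C$ is the derived operation. $\cong$ denotes isomorphism of (heterogeneous) algebras. *)

theory Defs
  imports Main
begin

section \<open>De Morgan algebras\<close>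

text \<open>
  Algebras are records of operations together with a carrier set. The operations are constrained
  on the carrier only, so that subsets of an algebra (kernels) are again algebras of the same kind.
\<close>

record 'a blat =
  carr :: "'a set"
  join :: "'a \<Rightarrow> 'a \<Rightarrow> 'a" (infixl "\<squnion>\<index>" 65)
  meet :: "'a \<Rightarrow> 'a \<Rightarrow> 'a" (infixl "\<sqinter>\<index>" 70)
  topel :: 'a ("\<top>\<index>")
  botel :: 'a ("\<bottom>\<index>")

record 'a dma = "'a blat" +
  neg :: "'a \<Rightarrow> 'a" ("\<sim>\<index> _" [81] 80)

definition le :: "('a, 'm) blat_scheme \<Rightarrow> 'a \<Rightarrow> 'a \<Rightarrow> bool" (infix "\<sqsubseteq>\<index>" 50)
  where "x \<sqsubseteq>\<^bsub>L\<^esub> y \<longleftrightarrow> x \<sqinter>\<^bsub>L\<^esub> y = x"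

locale bounded_dlattice =
  fixes L :: "('a, 'm) blat_scheme" (structure)
  assumes join_closed: "\<lbrakk>x \<in> carr L; y \<in> carr L\<rbrakk> \<Longrightarrow> x \<squnion> y \<in> carr L"
    and meet_closed: "\<lbrakk>x \<in> carr L; y \<in> carr L\<rbrakk> \<Longrightarrow> x \<sqinter> y \<in> carr L"
    and top_closed: "\<top> \<in> carr L"
    and bot_closed: "\<bottom> \<in> carr L"
    and join_comm: "\<lbrakk>x \<in> carr L; y \<in> carr L\<rbrakk> \<Longrightarrow> x \<squnion> y = y \<squnion> x"
    and meet_comm: "\<lbrakk>x \<in> carr L; y \<in> carr L\<rbrakk> \<Longrightarrow> x \<sqinter> y = y \<sqinter> x"
    and join_assoc:
      "\<lbrakk>x \<in> carr L; y \<in> carr L; z \<in> carr L\<rbrakk> \<Longrightarrow> (x \<squnion> y) \<squnion> z = x \<squnion> (y \<squnion> z)"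
    and meet_assoc:
      "\<lbrakk>x \<in> carr L; y \<in> carr L; z \<in> carr L\<rbrakk> \<Longrightarrow> (x \<sqinter> y) \<sqinter> z = x \<sqinter> (y \<sqinter> z)"
    and join_absorb: "\<lbrakk>x \<in> carr L; y \<in> carr L\<rbrakk> \<Longrightarrow> x \<squnion> (x \<sqinter> y) = x"
    and meet_absorb: "\<lbrakk>x \<in> carr L; y \<in> carr L\<rbrakk> \<Longrightarrow> x \<sqinter> (x \<squnion> y) = x"
    and meet_join_distrib:
      "\<lbrakk>x \<in> carr L; y \<in> carr L; z \<in> carr L\<rbrakk> \<Longrightarrow> x \<sqinter> (y \<squnion> z) = (x \<sqinter> y) \<squnion> (x \<sqinter> z)"
    and meet_top: "x \<in> carr L \<Longrightarrow> x \<sqinter> \<top> = x"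
    and join_bot: "x \<in> carr L \<Longrightarrow> x \<squnion> \<bottom> = x"

locale de_morgan_algebra = bounded_dlattice L
  for L :: "('a, 'm) dma_scheme" (structure) +
  assumes neg_closed: "x \<in> carr L \<Longrightarrow> \<sim> x \<in> carr L"
    and neg_neg: "x \<in> carr L \<Longrightarrow> \<sim> (\<sim> x) = x"
    and neg_join: "\<lbrakk>x \<in> carr L; y \<in> carr L\<rbrakk> \<Longrightarrow> \<sim> (x \<squnion> y) = \<sim> x \<sqinter> \<sim> y"

lemma (in de_morgan_algebra) neg_antimono:
  assumes "x \<in> carr L" "y \<in> carr L" "x \<sqsubseteq> y"
  shows "\<sim> y \<sqsubseteq> \<sim> x"
proof -
  have "x \<squnion> y = y"
    using assms join_absorb[of y x] by (metis join_comm le_def meet_closed meet_comm)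
  then show ?thesis
    using assms by (metis le_def meet_comm neg_closed neg_join)
qed

text \<open>A Boolean algebra is a De Morgan algebra whose negation is complementation.\<close>

locale boolean_dma = de_morgan_algebra L
  for L :: "('a, 'm) dma_scheme" (structure) +
  assumes join_neg: "x \<in> carr L \<Longrightarrow> x \<squnion> \<sim> x = \<top>"
    and meet_neg: "x \<in> carr L \<Longrightarrow> x \<sqinter> \<sim> x = \<bottom>"

definition blat_hom ::
  "('a, 'm) blat_scheme \<Rightarrow> ('b, 'n) blat_scheme \<Rightarrow> ('a \<Rightarrow> 'b) \<Rightarrow> bool"
  where "blat_hom A B f \<longleftrightarrow>
    (\<forall>x\<in>carr A. f x \<in> carr B) \<and>
    (\<forall>x\<in>carr A. \<forall>y\<in>carr A. f (x \<squnion>\<^bsub>A\<^esub> y) = f x \<squnion>\<^bsub>B\<^esub> f y) \<and>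
    (\<forall>x\<in>carr A. \<forall>y\<in>carr A. f (x \<sqinter>\<^bsub>A\<^esub> y) = f x \<sqinter>\<^bsub>B\<^esub> f y) \<and>
    f \<top>\<^bsub>A\<^esub> = \<top>\<^bsub>B\<^esub> \<and> f \<bottom>\<^bsub>A\<^esub> = \<bottom>\<^bsub>B\<^esub>"

definition dma_hom ::
  "('a, 'm) dma_scheme \<Rightarrow> ('b, 'n) dma_scheme \<Rightarrow> ('a \<Rightarrow> 'b) \<Rightarrow> bool"
  where "dma_hom A B f \<longleftrightarrow>
    blat_hom A B f \<and> (\<forall>x\<in>carr A. f (\<sim>\<^bsub>A\<^esub> x) = \<sim>\<^bsub>B\<^esub> (f x))"


section \<open>Topological quasi-Boolean algebras\<close>

record 'a tq = "'a dma" +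
  intr :: "'a \<Rightarrow> 'a" ("\<I>\<index>")

definition clos :: "('a, 'm) tq_scheme \<Rightarrow> 'a \<Rightarrow> 'a" ("\<C>\<index>")
  where "\<C>\<^bsub>T\<^esub> a = \<sim>\<^bsub>T\<^esub> (\<I>\<^bsub>T\<^esub> (\<sim>\<^bsub>T\<^esub> a))"

locale tqBa = de_morgan_algebra T
  for T :: "('a, 'm) tq_scheme" (structure) +
  assumes intr_closed: "a \<in> carr T \<Longrightarrow> \<I> a \<in> carr T"
    and T1: "\<lbrakk>a \<in> carr T; b \<in> carr T\<rbrakk> \<Longrightarrow> \<I> (a \<sqinter> b) = \<I> a \<sqinter> \<I> b"
    and T2: "a \<in> carr T \<Longrightarrow> \<I> (\<I> a) = \<I> a"
    and T3: "a \<in> carr T \<Longrightarrow> \<I> a \<sqsubseteq> a"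
    and T4: "\<I> \<top> = \<top>"

locale tqBa5 = tqBa T
  for T :: "('a, 'm) tq_scheme" (structure) +
  assumes T5: "a \<in> carr T \<Longrightarrow> \<C> (\<I> a) = \<I> a"

locale IA1 = tqBa5 T
  for T :: "('a, 'm) tq_scheme" (structure) +
  assumes T6: "a \<in> carr T \<Longrightarrow> \<I> a \<squnion> \<sim> (\<I> a) = \<top>"

locale IA2 = tqBa5 T
  for T :: "('a, 'm) tq_scheme" (structure) +
  assumes T7: "\<lbrakk>a \<in> carr T; b \<in> carr T\<rbrakk> \<Longrightarrow> \<I> a \<squnion> \<I> b = \<I> (a \<squnion> b)"

locale IA3 = tqBa5 T
  for T :: "('a, 'm) tq_scheme" (structure) +
  assumes T8: "\<lbrakk>a \<in> carr T; b \<in> carr T; \<I> a \<sqsubseteq> \<I> b; \<C> a \<sqsubseteq> \<C> b\<rbrakk> \<Longrightarrow> a \<sqsubseteq> b"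

locale pra = IA1 T + IA2 T + IA3 T
  for T :: "('a, 'm) tq_scheme" (structure)

definition tq_iso :: "('a, 'm) tq_scheme \<Rightarrow> ('b, 'n) tq_scheme \<Rightarrow> bool"
  where "tq_iso S T \<longleftrightarrow> (\<exists>f. bij_betw f (carr S) (carr T) \<and> dma_hom S T f \<and>
    (\<forall>a\<in>carr S. f (\<I>\<^bsub>S\<^esub> a) = \<I>\<^bsub>T\<^esub> (f a)))"


section \<open>Heterogeneous algebras\<close>

record ('d, 'i, 'c) het =
  alg :: "'d dma"
  lat_I :: "'i blat"
  lat_C :: "'c blat"
  emb_I :: "'i \<Rightarrow> 'd"
  emb_C :: "'c \<Rightarrow> 'd"
  iota :: "'d \<Rightarrow> 'i"
  gamma :: "'d \<Rightarrow> 'c"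

locale htqBa =
  fixes H :: "('d, 'i, 'c) het"
  assumes H1: "de_morgan_algebra (alg H)"
    and H2_I: "bounded_dlattice (lat_I H)"
    and H2_C: "bounded_dlattice (lat_C H)"
    and H3_I: "blat_hom (lat_I H) (alg H) (emb_I H)" "inj_on (emb_I H) (carr (lat_I H))"
    and H3_C: "blat_hom (lat_C H) (alg H) (emb_C H)" "inj_on (emb_C H) (carr (lat_C H))"
    and H4_I_closed: "a \<in> carr (alg H) \<Longrightarrow> iota H a \<in> carr (lat_I H)"
    and H4_I_meet: "\<lbrakk>a \<in> carr (alg H); b \<in> carr (alg H)\<rbrakk> \<Longrightarrow>
      iota H (a \<sqinter>\<^bsub>alg H\<^esub> b) = iota H a \<sqinter>\<^bsub>lat_I H\<^esub> iota H b"
    and H4_I_top: "iota H \<top>\<^bsub>alg H\<^esub> = \<top>\<^bsub>lat_I H\<^esub>"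
    and H4_I_bot: "iota H \<bottom>\<^bsub>alg H\<^esub> = \<bottom>\<^bsub>lat_I H\<^esub>"
    and H4_C_closed: "a \<in> carr (alg H) \<Longrightarrow> gamma H a \<in> carr (lat_C H)"
    and H4_C_join: "\<lbrakk>a \<in> carr (alg H); b \<in> carr (alg H)\<rbrakk> \<Longrightarrow>
      gamma H (a \<squnion>\<^bsub>alg H\<^esub> b) = gamma H a \<squnion>\<^bsub>lat_C H\<^esub> gamma H b"
    and H4_C_top: "gamma H \<top>\<^bsub>alg H\<^esub> = \<top>\<^bsub>lat_C H\<^esub>"
    and H4_C_bot: "gamma H \<bottom>\<^bsub>alg H\<^esub> = \<bottom>\<^bsub>lat_C H\<^esub>"
    and H5_I_adj: "\<lbrakk>\<alpha> \<in> carr (lat_I H); a \<in> carr (alg H)\<rbrakk> \<Longrightarrow>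
      emb_I H \<alpha> \<sqsubseteq>\<^bsub>alg H\<^esub> a \<longleftrightarrow> \<alpha> \<sqsubseteq>\<^bsub>lat_I H\<^esub> iota H a"
    and H5_C_adj: "\<lbrakk>a \<in> carr (alg H); \<xi> \<in> carr (lat_C H)\<rbrakk> \<Longrightarrow>
      gamma H a \<sqsubseteq>\<^bsub>lat_C H\<^esub> \<xi> \<longleftrightarrow> a \<sqsubseteq>\<^bsub>alg H\<^esub> emb_C H \<xi>"
    and H5_I_ret: "\<alpha> \<in> carr (lat_I H) \<Longrightarrow> iota H (emb_I H \<alpha>) = \<alpha>"
    and H5_C_ret: "\<xi> \<in> carr (lat_C H) \<Longrightarrow> gamma H (emb_C H \<xi>) = \<xi>"
    and H6: "a \<in> carr (alg H) \<Longrightarrow>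
      emb_C H (gamma H a) = \<sim>\<^bsub>alg H\<^esub> (emb_I H (iota H (\<sim>\<^bsub>alg H\<^esub> a)))"

text \<open>
  Under H7 the two lattices and the two embeddings coincide and the common lattice carries a
  negation, so the structure becomes a tuple \<open>(D, L, e, \<iota>, \<gamma>)\<close> with \<open>L\<close> a De Morgan algebra.
  Its underlying seven-component tuple duplicates \<open>e\<close> and the lattice reduct of \<open>L\<close>.
\<close>

record ('d, 'l) het5 =
  alg5 :: "'d dma"
  lat :: "'l dma"
  emb :: "'l \<Rightarrow> 'd"
  iota5 :: "'d \<Rightarrow> 'l"
  gamma5 :: "'d \<Rightarrow> 'l"

definition het_of :: "('d, 'l) het5 \<Rightarrow> ('d, 'l, 'l) het"
  where "het_of H =
    \<lparr>alg = alg5 H, lat_I = blat.truncate (lat H), lat_C = blat.truncate (lat H),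
     emb_I = emb H, emb_C = emb H, iota = iota5 H, gamma = gamma5 H\<rparr>"

locale htqBa5 =
  fixes H :: "('d, 'l) het5"
  assumes htqBa: "htqBa (het_of H)"
    and H7_lat: "de_morgan_algebra (lat H)"
    and H7_emb: "dma_hom (lat H) (alg5 H) (emb H)"

locale hIA1 = htqBa5 H
  for H :: "('d, 'l) het5" +
  assumes H8: "boolean_dma (lat H)"

locale hIA2 = htqBa5 H
  for H :: "('d, 'l) het5" +
  assumes H9: "\<lbrakk>a \<in> carr (alg5 H); b \<in> carr (alg5 H)\<rbrakk> \<Longrightarrow>
    iota5 H (a \<squnion>\<^bsub>alg5 H\<^esub> b) = iota5 H a \<squnion>\<^bsub>lat H\<^esub> iota5 H b"

locale hIA3 = htqBa5 H
  for H :: "('d, 'l) het5" +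
  assumes H10: "\<lbrakk>a \<in> carr (alg5 H); b \<in> carr (alg5 H);
      iota5 H a \<sqsubseteq>\<^bsub>lat H\<^esub> iota5 H b; gamma5 H a \<sqsubseteq>\<^bsub>lat H\<^esub> gamma5 H b\<rbrakk> \<Longrightarrow>
    a \<sqsubseteq>\<^bsub>alg5 H\<^esub> b"

locale hpra = hIA1 H + hIA2 H + hIA3 H
  for H :: "('d, 'l) het5"

definition het_iso :: "('d, 'i, 'c) het \<Rightarrow> ('e, 'j, 'k) het \<Rightarrow> bool"
  where "het_iso G H \<longleftrightarrow> (\<exists>f g h.
    bij_betw f (carr (alg G)) (carr (alg H)) \<and> dma_hom (alg G) (alg H) f \<and>
    bij_betw g (carr (lat_I G)) (carr (lat_I H)) \<and> blat_hom (lat_I G) (lat_I H) g \<and>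
    bij_betw h (carr (lat_C G)) (carr (lat_C H)) \<and> blat_hom (lat_C G) (lat_C H) h \<and>
    (\<forall>\<alpha>\<in>carr (lat_I G). f (emb_I G \<alpha>) = emb_I H (g \<alpha>)) \<and>
    (\<forall>\<xi>\<in>carr (lat_C G). f (emb_C G \<xi>) = emb_C H (h \<xi>)) \<and>
    (\<forall>a\<in>carr (alg G). g (iota G a) = iota H (f a)) \<and>
    (\<forall>a\<in>carr (alg G). h (gamma G a) = gamma H (f a)))"

definition het5_iso :: "('d, 'l) het5 \<Rightarrow> ('e, 'k) het5 \<Rightarrow> bool"
  where "het5_iso G H \<longleftrightarrow> (\<exists>f g.
    bij_betw f (carr (alg5 G)) (carr (alg5 H)) \<and> dma_hom (alg5 G) (alg5 H) f \<and>
    bij_betw g (carr (lat G)) (carr (lat H)) \<and> dma_hom (lat G) (lat H) g \<and>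
    (\<forall>\<alpha>\<in>carr (lat G). f (emb G \<alpha>) = emb H (g \<alpha>)) \<and>
    (\<forall>a\<in>carr (alg5 G). g (iota5 G a) = iota5 H (f a)) \<and>
    (\<forall>a\<in>carr (alg5 G). g (gamma5 G a) = gamma5 H (f a)))"


section \<open>The two constructions\<close>

text \<open>
  Kernels are subsets of the algebra, so the inclusions are the identity; they are left implicit
  in the kernel operations.
\<close>

definition left_kernel :: "'a tq \<Rightarrow> 'a blat"
  where "left_kernel T =
    \<lparr>carr = \<I>\<^bsub>T\<^esub> ` carr T,
     join = (\<lambda>\<alpha> \<beta>. \<I>\<^bsub>T\<^esub> (\<alpha> \<squnion>\<^bsub>T\<^esub> \<beta>)), meet = (\<lambda>\<alpha> \<beta>. \<I>\<^bsub>T\<^esub> (\<alpha> \<sqinter>\<^bsub>T\<^esub> \<beta>)),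
     topel = \<I>\<^bsub>T\<^esub> \<top>\<^bsub>T\<^esub>, botel = \<I>\<^bsub>T\<^esub> \<bottom>\<^bsub>T\<^esub>\<rparr>"

definition right_kernel :: "'a tq \<Rightarrow> 'a blat"
  where "right_kernel T =
    \<lparr>carr = \<C>\<^bsub>T\<^esub> ` carr T,
     join = (\<lambda>\<xi> \<chi>. \<C>\<^bsub>T\<^esub> (\<xi> \<squnion>\<^bsub>T\<^esub> \<chi>)), meet = (\<lambda>\<xi> \<chi>. \<C>\<^bsub>T\<^esub> (\<xi> \<sqinter>\<^bsub>T\<^esub> \<chi>)),
     topel = \<C>\<^bsub>T\<^esub> \<top>\<^bsub>T\<^esub>, botel = \<C>\<^bsub>T\<^esub> \<bottom>\<^bsub>T\<^esub>\<rparr>"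

definition tq_plus :: "'a tq \<Rightarrow> ('a, 'a, 'a) het"
  where "tq_plus T =
    \<lparr>alg = dma.truncate T, lat_I = left_kernel T, lat_C = right_kernel T,
     emb_I = id, emb_C = id, iota = \<I>\<^bsub>T\<^esub>, gamma = \<C>\<^bsub>T\<^esub>\<rparr>"

text \<open>
  For a tqBa5 the two kernels are identified; the left one serves as representative. The lemma
  \<open>kernels_agree\<close> below shows that, with their negations, the kernels are the same algebra.
\<close>

definition kernel5 :: "'a tq \<Rightarrow> 'a dma"
  where "kernel5 T = blat.extend (left_kernel T) (dma.fields (\<lambda>\<alpha>. \<I>\<^bsub>T\<^esub> (\<sim>\<^bsub>T\<^esub> \<alpha>)))"

definition tq_plus5 :: "'a tq \<Rightarrow> ('a, 'a) het5"
  where "tq_plus5 T =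
    \<lparr>alg5 = dma.truncate T, lat = kernel5 T, emb = id, iota5 = \<I>\<^bsub>T\<^esub>, gamma5 = \<C>\<^bsub>T\<^esub>\<rparr>"

definition het_minus :: "('d, 'i, 'c) het \<Rightarrow> 'd tq"
  where "het_minus H = dma.extend (alg H) (tq.fields (\<lambda>a. emb_I H (iota H a)))"

definition het_minus5 :: "('d, 'l) het5 \<Rightarrow> 'd tq"
  where "het_minus5 H = het_minus (het_of H)"

text \<open>The derived closure operation of \<^term>\<open>het_minus H\<close> is \<open>e\<^sub>C \<circ> \<gamma>\<close>.\<close>

lemma clos_het_minus:
  assumes "htqBa H" "a \<in> carr (alg H)"
  shows "\<C>\<^bsub>het_minus H\<^esub> a = emb_C H (gamma H a)"
  using htqBa.H6[OF assms] by (simp add: clos_def het_minus_def dma.defs tq.defs)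

lemma (in tqBa5) intr_clos:
  assumes "a \<in> carr T"
  shows "\<I> (\<C> a) = \<C> a"
proof -
  let ?b = "\<I> (\<sim> a)"
  have b: "?b \<in> carr T" using assms neg_closed intr_closed by blast
  have "\<sim> (\<I> (\<sim> ?b)) = ?b"
    using T5[of "\<sim> a"] assms by (simp add: neg_closed clos_def)
  then have "\<I> (\<sim> ?b) = \<sim> ?b"
    using neg_neg[of "\<I> (\<sim> ?b)"] b neg_closed intr_closed by simp
  then show ?thesis by (simp add: clos_def)
qed

lemma (in tqBa5) open_facts:
  assumes x: "x \<in> \<I> ` carr T"
  shows "x \<in> carr T" "\<I> x = x" "\<C> x = x"
  using x intr_closed T2 T5 by auto

lemma (in tqBa5) open_eqs:
  assumes x: "x \<in> \<I> ` carr T" and y: "y \<in> \<I> ` carr T"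
  shows "\<I> (x \<sqinter> y) = x \<sqinter> y" "\<C> (x \<sqinter> y) = x \<sqinter> y"
    "\<I> (x \<squnion> y) = x \<squnion> y" "\<C> (x \<squnion> y) = x \<squnion> y"
    "\<I> (\<sim> x) = \<sim> x" "\<C> (\<sim> x) = \<sim> x"
proof -
  note X = open_facts[OF x] and Y = open_facts[OF y]
  show m: "\<I> (x \<sqinter> y) = x \<sqinter> y" using X Y T1 by simp
  then show "\<C> (x \<sqinter> y) = x \<sqinter> y" using T5[of "x \<sqinter> y"] X Y meet_closed by simp
  have "\<I> (\<sim> x) = \<sim> x" if "x \<in> carr T" "\<C> x = x" for x
    using that neg_neg[of "\<I> (\<sim> x)"] neg_closed intr_closed by (simp add: clos_def)
  note n = this[OF X(1,3)] this[OF Y(1,3)]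
  then show "\<I> (\<sim> x) = \<sim> x" by simp
  show "\<C> (\<sim> x) = \<sim> x" using X neg_neg by (simp add: clos_def)
  have "\<I> (\<sim> (x \<squnion> y)) = \<sim> (x \<squnion> y)"
    using n X Y by (simp add: neg_join T1 neg_closed)
  then show c: "\<C> (x \<squnion> y) = x \<squnion> y" using X Y neg_neg join_closed by (simp add: clos_def)
  then show "\<I> (x \<squnion> y) = x \<squnion> y" using intr_clos[of "x \<squnion> y"] X Y join_closed by simp
qed

lemma kernels_agree:
  fixes T :: "'a tq"
  assumes "tqBa5 T"
  shows "carr (left_kernel T) = carr (right_kernel T)"
    and "\<lbrakk>x \<in> carr (left_kernel T); y \<in> carr (left_kernel T)\<rbrakk> \<Longrightarrow>
      x \<squnion>\<^bsub>left_kernel T\<^esub> y = x \<squnion>\<^bsub>right_kernel T\<^esub> y"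
    and "\<lbrakk>x \<in> carr (left_kernel T); y \<in> carr (left_kernel T)\<rbrakk> \<Longrightarrow>
      x \<sqinter>\<^bsub>left_kernel T\<^esub> y = x \<sqinter>\<^bsub>right_kernel T\<^esub> y"
    and "\<top>\<^bsub>left_kernel T\<^esub> = \<top>\<^bsub>right_kernel T\<^esub>"
    and "\<bottom>\<^bsub>left_kernel T\<^esub> = \<bottom>\<^bsub>right_kernel T\<^esub>"
    and "x \<in> carr (left_kernel T) \<Longrightarrow> \<I>\<^bsub>T\<^esub> (\<sim>\<^bsub>T\<^esub> x) = \<C>\<^bsub>T\<^esub> (\<sim>\<^bsub>T\<^esub> x)"
proof -
  interpret tqBa5 T by fact
  have top: "\<top>\<^bsub>T\<^esub> \<in> \<I>\<^bsub>T\<^esub> ` carr T" using T4 top_closed by (metis image_eqI)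
  have nb: "\<sim>\<^bsub>T\<^esub> \<bottom>\<^bsub>T\<^esub> = \<top>\<^bsub>T\<^esub>"
    by (metis bot_closed join_bot join_comm meet_top neg_closed neg_join neg_neg meet_comm top_closed)
  have nt: "\<sim>\<^bsub>T\<^esub> \<top>\<^bsub>T\<^esub> = \<bottom>\<^bsub>T\<^esub>" using nb neg_neg bot_closed by metis
  have C: "\<C>\<^bsub>T\<^esub> \<bottom>\<^bsub>T\<^esub> = \<bottom>\<^bsub>T\<^esub>" by (simp add: clos_def nb T4 nt)
  have I: "\<I>\<^bsub>T\<^esub> \<bottom>\<^bsub>T\<^esub> = \<bottom>\<^bsub>T\<^esub>" using intr_clos[OF bot_closed] C by simp
  show "carr (left_kernel T) = carr (right_kernel T)"
    unfolding left_kernel_def right_kernel_def blat.simps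
  proof (intro equalityI subsetI)
    fix x assume "x \<in> \<I>\<^bsub>T\<^esub> ` carr T"
    then show "x \<in> \<C>\<^bsub>T\<^esub> ` carr T" using open_facts by (metis image_eqI)
  next
    fix x assume "x \<in> \<C>\<^bsub>T\<^esub> ` carr T"
    then obtain a where a: "a \<in> carr T" "x = \<C>\<^bsub>T\<^esub> a" by blast
    have "\<C>\<^bsub>T\<^esub> a \<in> carr T" using a neg_closed intr_closed by (simp add: clos_def)
    then show "x \<in> \<I>\<^bsub>T\<^esub> ` carr T" using a intr_clos by (metis image_eqI)
  qed
  show "\<top>\<^bsub>left_kernel T\<^esub> = \<top>\<^bsub>right_kernel T\<^esub>"
    using open_facts[OF top] by (simp add: left_kernel_def right_kernel_def)
  show "\<bottom>\<^bsub>left_kernel T\<^esub> = \<bottom>\<^bsub>right_kernel T\<^esub>"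
    using C I by (simp add: left_kernel_def right_kernel_def)
qed (use tqBa5.open_eqs[OF assms] in \<open>simp_all add: left_kernel_def right_kernel_def\<close>)

end

theory Submission
  imports Defs
begin

text \<open>
  An interior operator and a coreflective sublattice are two descriptions of the same data. Call
  \<open>x\<close> open if \<open>I x = x\<close> and closed if \<open>C x = x\<close>. By \<open>le_intr_iff\<close>, \<open>I a\<close> is the greatest open
  element below \<open>a\<close>, and dually, by \<open>clos_le_iff\<close>, \<open>C a\<close> is the least closed element above \<open>a\<close>.
  This is precisely the pair of adjunctions in the definition of a heterogeneous algebra,
  with the inclusions of the kernels as embeddings. Open elements are closed under finite meets by
  T1 and T4, and under finite joins because \<open>I (x \<squnion> y)\<close> lies above the open elements \<open>x\<close> and \<open>y\<close>;
  negation exchanges open and closed elements. Hence the kernels are bounded sublattices, on which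
  the kernel operations coincide with those of the algebra (\<open>left_kernel_incl\<close>,
  \<open>right_kernel_incl\<close>), and distributivity is inherited (\<open>htqBa_of_inclusions\<close>).

  Conversely, an adjunction \<open>e \<stileturn> \<iota>\<close> with \<open>\<iota> \<circ> e = id\<close> makes \<open>e \<circ> \<iota>\<close> deflationary and idempotent,
  and it preserves finite meets because both maps do (\<open>tqBa_het_minus\<close>). Its fixed points form the
  image of \<open>e\<close>. So the round trip from an algebra is literally the identity, whereas the round trip
  from a heterogeneous algebra replaces each lattice by its image under the embedding,
  and the embedding is the required isomorphism (\<open>het_iso_round_trip\<close>).

  The further conditions correspond one by one. T5 says that open and closed elements agree, hence
  that they form a De Morgan subalgebra, and its counterpart is that \<open>e\<close> is a common embedding for
  both kernels. Under T5, condition T6 is excluded middle in the kernel, which for a De Morgan algebra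
  is the Boolean property. T7 and T8 are H9 and H10 read through the embedding, which preserves
  joins and both preserves and reflects the order.
\<close>

section \<open>Lattice preliminaries\<close>

context bounded_dlattice
begin

lemma le_refl: "x \<in> carr L \<Longrightarrow> x \<sqsubseteq> x"
  unfolding le_def by (metis join_absorb meet_absorb meet_closed)

lemma le_antisym: "\<lbrakk>x \<in> carr L; y \<in> carr L; x \<sqsubseteq> y; y \<sqsubseteq> x\<rbrakk> \<Longrightarrow> x = y"
  unfolding le_def by (metis meet_comm)

lemma le_trans:
  "\<lbrakk>x \<in> carr L; y \<in> carr L; z \<in> carr L; x \<sqsubseteq> y; y \<sqsubseteq> z\<rbrakk> \<Longrightarrow> x \<sqsubseteq> z"
  unfolding le_def by (metis meet_assoc)

lemma le_iff_join: "\<lbrakk>x \<in> carr L; y \<in> carr L\<rbrakk> \<Longrightarrow> x \<sqsubseteq> y \<longleftrightarrow> x \<squnion> y = y"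
  unfolding le_def by (metis join_absorb join_comm meet_absorb meet_comm)

lemma le_join1: "\<lbrakk>x \<in> carr L; y \<in> carr L\<rbrakk> \<Longrightarrow> x \<sqsubseteq> x \<squnion> y"
  unfolding le_def by (rule meet_absorb)

lemma le_join2: "\<lbrakk>x \<in> carr L; y \<in> carr L\<rbrakk> \<Longrightarrow> y \<sqsubseteq> x \<squnion> y"
  using le_join1[of y x] join_comm[of x y] by simp

lemma join_least:
  "\<lbrakk>x \<in> carr L; y \<in> carr L; z \<in> carr L; x \<sqsubseteq> z; y \<sqsubseteq> z\<rbrakk> \<Longrightarrow> x \<squnion> y \<sqsubseteq> z"
  by (simp add: le_iff_join join_assoc join_closed)

lemma bot_least: "x \<in> carr L \<Longrightarrow> \<bottom> \<sqsubseteq> x"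
  by (simp add: le_iff_join bot_closed join_comm[of "\<bottom>"] join_bot)

end

context de_morgan_algebra
begin

lemma neg_meet:
  assumes "x \<in> carr L" "y \<in> carr L"
  shows "\<sim> (x \<sqinter> y) = \<sim> x \<squnion> \<sim> y"
  using assms neg_join[of "\<sim> x" "\<sim> y"] by (metis join_closed neg_closed neg_neg)

lemma neg_bot: "\<sim> \<bottom> = \<top>"
  by (metis bot_closed join_bot join_comm meet_comm meet_top neg_closed neg_join neg_neg top_closed)

lemma neg_top: "\<sim> \<top> = \<bottom>"
  using neg_neg[OF bot_closed] by (simp add: neg_bot)

lemma le_neg_swap: "\<lbrakk>a \<in> carr L; b \<in> carr L\<rbrakk> \<Longrightarrow> a \<sqsubseteq> b \<longleftrightarrow> \<sim> b \<sqsubseteq> \<sim> a"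
  by (metis neg_antimono neg_closed neg_neg)

end

text \<open>
  The lattice and De Morgan axioms are equations, so they are reflected along injective
  homomorphisms. This is how a kernel inherits its structure from the algebra it is included in:
  only closure under the kernel operations has to be checked.
\<close>

lemma bounded_dlattice_reflect:
  fixes K :: "('a, 'm) blat_scheme" and L :: "('b, 'n) blat_scheme"
  assumes "bounded_dlattice L" and hom: "blat_hom K L f" and inj: "inj_on f (carr K)"
    and closed: "\<And>x y. \<lbrakk>x \<in> carr K; y \<in> carr K\<rbrakk> \<Longrightarrow> x \<squnion>\<^bsub>K\<^esub> y \<in> carr K"
      "\<And>x y. \<lbrakk>x \<in> carr K; y \<in> carr K\<rbrakk> \<Longrightarrow> x \<sqinter>\<^bsub>K\<^esub> y \<in> carr K"
      "\<top>\<^bsub>K\<^esub> \<in> carr K" "\<bottom>\<^bsub>K\<^esub> \<in> carr K"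
  shows "bounded_dlattice K"
proof -
  interpret bounded_dlattice L by fact
  note h = hom[unfolded blat_hom_def]
  note eqI = inj_onD[OF inj]
  show ?thesis
    by unfold_locales
      (auto intro!: eqI simp: closed h join_assoc meet_assoc join_absorb meet_absorb
        meet_join_distrib meet_top join_bot, (use h join_comm meet_comm in blast)+)
qed

lemma de_morgan_algebra_reflect:
  fixes K :: "('a, 'm) dma_scheme" and L :: "('b, 'n) dma_scheme"
  assumes "de_morgan_algebra L" and "bounded_dlattice K" and hom: "dma_hom K L f"
    and inj: "inj_on f (carr K)" and closed: "\<And>x. x \<in> carr K \<Longrightarrow> \<sim>\<^bsub>K\<^esub> x \<in> carr K"
  shows "de_morgan_algebra K"
proof -
  interpret L: de_morgan_algebra L by fact
  interpret K: bounded_dlattice K by fact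
  note h = hom[unfolded dma_hom_def blat_hom_def]
  note eqI = inj_onD[OF inj]
  show ?thesis
    by unfold_locales
      (auto intro!: eqI simp: closed h K.join_closed K.meet_closed L.neg_neg L.neg_join)
qed

text \<open>The order is defined by an equation as well, so the same reflection applies to it.\<close>

lemma le_reflect:
  assumes "bounded_dlattice K" "blat_hom K L f" "inj_on f (carr K)" "x \<in> carr K" "y \<in> carr K"
  shows "f x \<sqsubseteq>\<^bsub>L\<^esub> f y \<longleftrightarrow> x \<sqsubseteq>\<^bsub>K\<^esub> y"
  using assms(2-5) bounded_dlattice.meet_closed[OF assms(1,4,5)]
  unfolding le_def blat_hom_def by (metis inj_onD)

text \<open>Negating excluded middle gives \<open>x \<sqinter> \<sim> x = \<bottom>\<close>, by the De Morgan laws.\<close>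

lemma (in de_morgan_algebra) boolean_dmaI:
  assumes "\<And>x. x \<in> carr L \<Longrightarrow> x \<squnion> \<sim> x = \<top>"
  shows "boolean_dma L"
proof unfold_locales
  fix x assume x: "x \<in> carr L"
  show "x \<squnion> \<sim> x = \<top>" using x by (rule assms)
  have "x \<sqinter> \<sim> x = \<sim> (\<sim> x \<squnion> x)" using x by (simp add: neg_join neg_closed neg_neg)
  also have "\<dots> = \<bottom>" using x assms by (simp add: join_comm[of "\<sim> x"] neg_closed neg_top)
  finally show "x \<sqinter> \<sim> x = \<bottom>" .
qed

section \<open>Open and closed elements\<close>

context tqBa
begin

lemma intr_mono:
  "\<lbrakk>a \<in> carr T; b \<in> carr T; a \<sqsubseteq> b\<rbrakk> \<Longrightarrow> \<I> a \<sqsubseteq> \<I> b"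
  unfolding le_def by (metis T1)

lemma intr_bot: "\<I> \<bottom> = \<bottom>"
  by (simp add: le_antisym intr_closed bot_closed T3 bot_least)

text \<open>For open \<open>x\<close> this is the adjunction between the inclusion of the left kernel and \<open>I\<close>.\<close>

lemma le_intr_iff:
  assumes "x \<in> carr T" "a \<in> carr T" "\<I> x = x"
  shows "x \<sqsubseteq> a \<longleftrightarrow> x \<sqsubseteq> \<I> a"
  using assms intr_mono[of x a] T3[of a] le_trans[of x "\<I> a" a] intr_closed by auto

lemma intr_join:
  assumes x: "x \<in> carr T" "\<I> x = x" and y: "y \<in> carr T" "\<I> y = y"
  shows "\<I> (x \<squnion> y) = x \<squnion> y"
proof -
  have "x \<squnion> y \<sqsubseteq> \<I> (x \<squnion> y)"
    using x y by (intro join_least) (simp_all add: intr_closed join_closed le_join1 le_join2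
        flip: le_intr_iff)
  then show ?thesis using x y by (simp add: le_antisym intr_closed join_closed T3)
qed

text \<open>The facts about closed elements are those about open elements read through the negation.\<close>

lemma clos_closed: "a \<in> carr T \<Longrightarrow> \<C> a \<in> carr T"
  by (simp add: clos_def neg_closed intr_closed)

lemma clos_join: "\<lbrakk>a \<in> carr T; b \<in> carr T\<rbrakk> \<Longrightarrow> \<C> (a \<squnion> b) = \<C> a \<squnion> \<C> b"
  by (simp add: clos_def neg_join T1 neg_meet neg_closed intr_closed)

lemma clos_clos: "a \<in> carr T \<Longrightarrow> \<C> (\<C> a) = \<C> a"
  by (simp add: clos_def neg_neg neg_closed intr_closed T2)

lemma clos_top: "\<C> \<top> = \<top>"
  by (simp add: clos_def neg_top neg_bot intr_bot)

lemma clos_bot: "\<C> \<bottom> = \<bottom>"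
  by (simp add: clos_def neg_top neg_bot T4)

lemma clos_fixed_iff: "x \<in> carr T \<Longrightarrow> \<C> x = x \<longleftrightarrow> \<I> (\<sim> x) = \<sim> x"
  by (metis clos_def intr_closed neg_closed neg_neg)

lemma clos_meet:
  assumes x: "x \<in> carr T" "\<C> x = x" and y: "y \<in> carr T" "\<C> y = y"
  shows "\<C> (x \<sqinter> y) = x \<sqinter> y"
  using x y intr_join[of "\<sim> x" "\<sim> y"]
  by (simp add: clos_fixed_iff meet_closed neg_meet neg_closed)

lemma clos_le_iff:
  assumes a: "a \<in> carr T" and x: "x \<in> carr T" "\<C> x = x"
  shows "\<C> a \<sqsubseteq> x \<longleftrightarrow> a \<sqsubseteq> x"
proof -
  have "\<C> a \<sqsubseteq> x \<longleftrightarrow> \<sim> x \<sqsubseteq> \<I> (\<sim> a)"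
    using a x le_neg_swap[of "\<C> a" x]
    by (simp add: clos_closed) (simp add: clos_def neg_neg neg_closed intr_closed)
  also have "\<dots> \<longleftrightarrow> \<sim> x \<sqsubseteq> \<sim> a"
    using a x le_intr_iff[of "\<sim> x" "\<sim> a"] by (simp add: neg_closed clos_fixed_iff)
  finally show ?thesis using a x le_neg_swap[of a x] by simp
qed

end

section \<open>From an algebra to its heterogeneous algebra\<close>

lemma truncate_simps [simp]:
  "carr (dma.truncate T) = carr T" "join (dma.truncate T) = join T"
  "meet (dma.truncate T) = meet T" "topel (dma.truncate T) = topel T"
  "botel (dma.truncate T) = botel T" "neg (dma.truncate T) = neg T"
  "le (dma.truncate T) = le T"
  by (simp_all add: dma.defs le_def fun_eq_iff)

lemma de_morgan_algebra_truncate: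
  "de_morgan_algebra (dma.truncate T) \<longleftrightarrow> de_morgan_algebra T"
  by (simp add: de_morgan_algebra_def de_morgan_algebra_axioms_def bounded_dlattice_def)

lemma blat_hom_idI:
  assumes "carr K \<subseteq> carr L"
    and "\<And>x y. \<lbrakk>x \<in> carr K; y \<in> carr K\<rbrakk> \<Longrightarrow> x \<squnion>\<^bsub>K\<^esub> y = x \<squnion>\<^bsub>L\<^esub> y"
    and "\<And>x y. \<lbrakk>x \<in> carr K; y \<in> carr K\<rbrakk> \<Longrightarrow> x \<sqinter>\<^bsub>K\<^esub> y = x \<sqinter>\<^bsub>L\<^esub> y"
    and "\<top>\<^bsub>K\<^esub> = \<top>\<^bsub>L\<^esub>" "\<bottom>\<^bsub>K\<^esub> = \<bottom>\<^bsub>L\<^esub>"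
  shows "blat_hom K L id"
  using assms by (auto simp: blat_hom_def)

lemma open_iff:
  assumes "tqBa T" shows "x \<in> \<I>\<^bsub>T\<^esub> ` carr T \<longleftrightarrow> x \<in> carr T \<and> \<I>\<^bsub>T\<^esub> x = x"
  using tqBa.T2[OF assms] tqBa.intr_closed[OF assms] by force

lemma closed_iff:
  assumes "tqBa T" shows "x \<in> \<C>\<^bsub>T\<^esub> ` carr T \<longleftrightarrow> x \<in> carr T \<and> \<C>\<^bsub>T\<^esub> x = x"
  using tqBa.clos_clos[OF assms] tqBa.clos_closed[OF assms] by force

lemma left_kernel_incl:
  assumes "tqBa T"
  shows "blat_hom (left_kernel T) T id"
proof -
  interpret tqBa T by fact
  show ?thesis
    by (rule blat_hom_idI)
      (auto simp: left_kernel_def open_iff[OF assms] intr_closed intr_join T1 T4 intr_bot)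
qed

lemma right_kernel_incl:
  assumes "tqBa T"
  shows "blat_hom (right_kernel T) T id"
proof -
  interpret tqBa T by fact
  show ?thesis
    by (rule blat_hom_idI)
      (auto simp: right_kernel_def closed_iff[OF assms] clos_closed clos_join clos_meet clos_top clos_bot)
qed

text \<open>
  The two kernels enter only through their carriers and through the fact that their inclusions are
  homomorphisms. Stated this way, the lemma serves both the general construction, with the left and
  the right kernel, and the construction with identified kernels, where the left kernel takes both
  places although its operations differ from those of the right kernel off the common carrier.
\<close>

lemma htqBa_of_inclusions:
  fixes T :: "'a tq"
  assumes T: "tqBa T"
    and K: "carr K = \<I>\<^bsub>T\<^esub> ` carr T" "blat_hom K T id"
    and K': "carr K' = \<C>\<^bsub>T\<^esub> ` carr T" "blat_hom K' T id"
  shows "htqBa \<lparr>alg = dma.truncate T, lat_I = K, lat_C = K', emb_I = id, emb_C = id,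
    iota = \<I>\<^bsub>T\<^esub>, gamma = \<C>\<^bsub>T\<^esub>\<rparr>"
proof -
  interpret tqBa T by fact
  have k: "x \<in> carr K \<longleftrightarrow> x \<in> carr T \<and> \<I>\<^bsub>T\<^esub> x = x" for x
    using K(1) open_iff[OF T] by simp
  have k': "x \<in> carr K' \<longleftrightarrow> x \<in> carr T \<and> \<C>\<^bsub>T\<^esub> x = x" for x
    using K'(1) closed_iff[OF T] by simp
  have h: "x \<squnion>\<^bsub>K\<^esub> y = x \<squnion>\<^bsub>T\<^esub> y" "x \<sqinter>\<^bsub>K\<^esub> y = x \<sqinter>\<^bsub>T\<^esub> y" if "x \<in> carr K" "y \<in> carr K" for x y
    using that K(2) by (auto simp: blat_hom_def)
  have h': "x \<squnion>\<^bsub>K'\<^esub> y = x \<squnion>\<^bsub>T\<^esub> y" "x \<sqinter>\<^bsub>K'\<^esub> y = x \<sqinter>\<^bsub>T\<^esub> y" if "x \<in> carr K'" "y \<in> carr K'" for x y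
    using that K'(2) by (auto simp: blat_hom_def)
  have b: "\<top>\<^bsub>K\<^esub> = \<top>\<^bsub>T\<^esub>" "\<bottom>\<^bsub>K\<^esub> = \<bottom>\<^bsub>T\<^esub>" "\<top>\<^bsub>K'\<^esub> = \<top>\<^bsub>T\<^esub>" "\<bottom>\<^bsub>K'\<^esub> = \<bottom>\<^bsub>T\<^esub>"
    using K(2) K'(2) by (auto simp: blat_hom_def)
  have lat: "bounded_dlattice K"
    by (rule bounded_dlattice_reflect[OF bounded_dlattice_axioms K(2)])
      (simp_all add: h b, simp_all add: k join_closed meet_closed top_closed bot_closed intr_join
        T1 T4 intr_bot)
  have lat': "bounded_dlattice K'"
    by (rule bounded_dlattice_reflect[OF bounded_dlattice_axioms K'(2)])
      (simp_all add: h' b, simp_all add: k' join_closed meet_closed top_closed bot_closed clos_join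
        clos_meet clos_top clos_bot)
  have I: "\<I>\<^bsub>T\<^esub> a \<in> carr K" and C: "\<C>\<^bsub>T\<^esub> a \<in> carr K'" if "a \<in> carr T" for a
    using that K(1) K'(1) by auto
  have ord: "x \<sqsubseteq>\<^bsub>K\<^esub> y \<longleftrightarrow> x \<sqsubseteq>\<^bsub>T\<^esub> y" if "x \<in> carr K" "y \<in> carr K" for x y
    using le_reflect[OF lat K(2) _ that] by simp
  have ord': "x \<sqsubseteq>\<^bsub>K'\<^esub> y \<longleftrightarrow> x \<sqsubseteq>\<^bsub>T\<^esub> y" if "x \<in> carr K'" "y \<in> carr K'" for x y
    using le_reflect[OF lat' K'(2) _ that] by simp
  have trunc: "blat_hom K (dma.truncate T) id" "blat_hom K' (dma.truncate T) id"
    using K(2) K'(2) by (simp_all add: blat_hom_def)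
  show ?thesis
  proof (rule htqBa.intro, unfold het.simps)
    show "de_morgan_algebra (dma.truncate T)"
      by (simp add: de_morgan_algebra_truncate de_morgan_algebra_axioms)
    fix \<alpha> a assume "\<alpha> \<in> carr K" "a \<in> carr (dma.truncate T)"
    then show "id \<alpha> \<sqsubseteq>\<^bsub>dma.truncate T\<^esub> a \<longleftrightarrow> \<alpha> \<sqsubseteq>\<^bsub>K\<^esub> \<I>\<^bsub>T\<^esub> a"
      using ord[OF _ I] le_intr_iff k by simp
  next
    fix a \<xi> assume "a \<in> carr (dma.truncate T)" "\<xi> \<in> carr K'"
    then show "\<C>\<^bsub>T\<^esub> a \<sqsubseteq>\<^bsub>K'\<^esub> \<xi> \<longleftrightarrow> a \<sqsubseteq>\<^bsub>dma.truncate T\<^esub> id \<xi>"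
      using ord'[OF C] clos_le_iff k' by simp
  qed (use lat lat' trunc in \<open>simp_all add: I C h h' b T1 T4 intr_bot clos_join clos_top clos_bot\<close>,
      simp_all add: k k' clos_def)
qed

theorem htqBa_tq_plus:
  assumes "tqBa T" shows "htqBa (tq_plus T)"
  unfolding tq_plus_def
  by (rule htqBa_of_inclusions)
    (simp_all add: assms left_kernel_incl right_kernel_incl, simp_all add: left_kernel_def right_kernel_def)

lemma kernel5_simps [simp]:
  "blat.truncate (kernel5 T) = left_kernel T" "carr (kernel5 T) = \<I>\<^bsub>T\<^esub> ` carr T"
  "x \<squnion>\<^bsub>kernel5 T\<^esub> y = \<I>\<^bsub>T\<^esub> (x \<squnion>\<^bsub>T\<^esub> y)" "x \<sqinter>\<^bsub>kernel5 T\<^esub> y = \<I>\<^bsub>T\<^esub> (x \<sqinter>\<^bsub>T\<^esub> y)"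
  "\<top>\<^bsub>kernel5 T\<^esub> = \<I>\<^bsub>T\<^esub> \<top>\<^bsub>T\<^esub>" "\<bottom>\<^bsub>kernel5 T\<^esub> = \<I>\<^bsub>T\<^esub> \<bottom>\<^bsub>T\<^esub>" "\<sim>\<^bsub>kernel5 T\<^esub> x = \<I>\<^bsub>T\<^esub> (\<sim>\<^bsub>T\<^esub> x)"
  by (simp_all add: kernel5_def left_kernel_def blat.defs dma.defs)

lemma het_of_tq_plus5:
  "het_of (tq_plus5 T) = \<lparr>alg = dma.truncate T, lat_I = left_kernel T, lat_C = left_kernel T,
    emb_I = id, emb_C = id, iota = \<I>\<^bsub>T\<^esub>, gamma = \<C>\<^bsub>T\<^esub>\<rparr>"
  by (simp add: het_of_def tq_plus5_def)

text \<open>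
  T5 is what makes the left kernel usable on both sides: it equates open and closed elements, so
  \<open>C\<close> takes values in the left kernel, and it makes the negation of an open element open, so the
  kernel negation \<open>I (\<sim> \<alpha>)\<close> is the restriction of \<open>\<sim>\<close>.
\<close>

theorem htqBa5_tq_plus5:
  fixes T :: "'a tq"
  assumes tqBa5: "tqBa5 T" shows "htqBa5 (tq_plus5 T)"
proof (rule htqBa5.intro)
  interpret tqBa5 T by fact
  have T: "tqBa T" by unfold_locales
  have eq: "carr (left_kernel T) = \<C>\<^bsub>T\<^esub> ` carr T"
    using kernels_agree(1)[OF tqBa5] by (simp add: right_kernel_def)
  show H: "htqBa (het_of (tq_plus5 T))"
    unfolding het_of_tq_plus5
    by (rule htqBa_of_inclusions)
      (simp_all add: T eq left_kernel_incl, simp add: left_kernel_def flip: eq)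
  have hom: "dma_hom (kernel5 T) (dma.truncate T) id"
    using left_kernel_incl[OF T] open_eqs(5)
    by (simp add: dma_hom_def blat_hom_def left_kernel_def)
  then show "dma_hom (lat (tq_plus5 T)) (alg5 (tq_plus5 T)) (emb (tq_plus5 T))"
    by (simp add: tq_plus5_def)
  have "bounded_dlattice (kernel5 T) \<longleftrightarrow> bounded_dlattice (left_kernel T)"
    by (simp add: bounded_dlattice_def left_kernel_def)
  then have "bounded_dlattice (kernel5 T)"
    using htqBa.H2_I[OF H] by (simp add: het_of_tq_plus5)
  then have "de_morgan_algebra (kernel5 T)"
    by (intro de_morgan_algebra_reflect[OF _ _ hom])
      (simp_all add: de_morgan_algebra_truncate de_morgan_algebra_axioms hom
        neg_closed open_facts(1))
  then show "de_morgan_algebra (lat (tq_plus5 T))" by (simp add: tq_plus5_def)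
qed

theorem hIA1_tq_plus5:
  fixes T :: "'a tq"
  assumes "IA1 T" shows "hIA1 (tq_plus5 T)"
proof -
  interpret IA1 T by fact
  interpret H: htqBa5 "tq_plus5 T" by (rule htqBa5_tq_plus5) unfold_locales
  interpret K: de_morgan_algebra "kernel5 T" using H.H7_lat by (simp add: tq_plus5_def)
  have "boolean_dma (kernel5 T)"
  proof (rule K.boolean_dmaI)
    fix x assume "x \<in> carr (kernel5 T)"
    then show "x \<squnion>\<^bsub>kernel5 T\<^esub> \<sim>\<^bsub>kernel5 T\<^esub> x = \<top>\<^bsub>kernel5 T\<^esub>"
      using T6[of x] open_facts[of x] open_eqs(5)[of x x] by simp
  qed
  then show ?thesis
    by (intro hIA1.intro hIA1_axioms.intro H.htqBa5_axioms) (simp add: tq_plus5_def)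
qed

theorem hIA2_tq_plus5:
  fixes T :: "'a tq"
  assumes "IA2 T" shows "hIA2 (tq_plus5 T)"
proof -
  interpret IA2 T by fact
  interpret H: htqBa5 "tq_plus5 T" by (rule htqBa5_tq_plus5) unfold_locales
  show ?thesis
    by unfold_locales (simp add: tq_plus5_def T2 T7[symmetric] intr_closed join_closed)
qed

theorem hIA3_tq_plus5:
  fixes T :: "'a tq"
  assumes "IA3 T" shows "hIA3 (tq_plus5 T)"
proof -
  interpret IA3 T by fact
  interpret H: htqBa5 "tq_plus5 T" by (rule htqBa5_tq_plus5) unfold_locales
  \<comment> \<open>The kernel order applies \<open>I\<close> to meets. Interiors are open and, by T5, so are closures,
    and meets of open elements are open, so this is the order of the algebra.\<close>
  have "\<I>\<^bsub>T\<^esub> (\<I>\<^bsub>T\<^esub> a \<sqinter>\<^bsub>T\<^esub> \<I>\<^bsub>T\<^esub> b) = \<I>\<^bsub>T\<^esub> a \<sqinter>\<^bsub>T\<^esub> \<I>\<^bsub>T\<^esub> b"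
    "\<I>\<^bsub>T\<^esub> (\<C>\<^bsub>T\<^esub> a \<sqinter>\<^bsub>T\<^esub> \<C>\<^bsub>T\<^esub> b) = \<C>\<^bsub>T\<^esub> a \<sqinter>\<^bsub>T\<^esub> \<C>\<^bsub>T\<^esub> b" if "a \<in> carr T" "b \<in> carr T" for a b
    using that by (simp_all add: T1 T2 intr_clos intr_closed clos_closed)
  then show ?thesis
    by unfold_locales (use T8 in \<open>simp add: tq_plus5_def le_def\<close>)
qed

section \<open>From a heterogeneous algebra to its algebra\<close>

lemma het_minus_simps [simp]:
  "carr (het_minus H) = carr (alg H)" "join (het_minus H) = join (alg H)"
  "meet (het_minus H) = meet (alg H)" "topel (het_minus H) = topel (alg H)"
  "botel (het_minus H) = botel (alg H)" "neg (het_minus H) = neg (alg H)"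
  "le (het_minus H) = le (alg H)" "\<I>\<^bsub>het_minus H\<^esub> a = emb_I H (iota H a)"
  "dma.truncate (het_minus H) = alg H"
  by (simp_all add: het_minus_def dma.defs tq.defs le_def fun_eq_iff)

text \<open>
  T3 is the counit of \<open>e\<^sub>I \<stileturn> \<iota>\<close>, obtained from the adjunction at \<open>\<alpha> = \<iota> a\<close>; T2 is the retraction law;
  T1 and T4 hold because \<open>\<iota>\<close> and \<open>e\<^sub>I\<close> preserve finite meets.
\<close>

theorem tqBa_het_minus:
  assumes "htqBa H" shows "tqBa (het_minus H)"
proof -
  interpret htqBa H by fact
  interpret D: de_morgan_algebra "alg H" by (rule H1)
  interpret I: bounded_dlattice "lat_I H" by (rule H2_I)
  note e = H3_I(1)[unfolded blat_hom_def]
  have M: "de_morgan_algebra (het_minus H)"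
    using H1 by (simp flip: de_morgan_algebra_truncate[of "het_minus H"])
  show ?thesis
  proof (rule tqBa.intro[OF M], unfold_locales)
    fix a assume "a \<in> carr (het_minus H)"
    then show "\<I>\<^bsub>het_minus H\<^esub> a \<sqsubseteq>\<^bsub>het_minus H\<^esub> a"
      by (simp add: H5_I_adj H4_I_closed I.le_refl)
  qed (simp_all add: e H4_I_closed H4_I_meet H4_I_top H5_I_ret)
qed

lemma het_of_simps [simp]:
  "alg (het_of H) = alg5 H" "emb_I (het_of H) = emb H" "emb_C (het_of H) = emb H"
  "iota (het_of H) = iota5 H" "gamma (het_of H) = gamma5 H"
  "carr (lat_I (het_of H)) = carr (lat H)" "carr (lat_C (het_of H)) = carr (lat H)"
  by (simp_all add: het_of_def blat.defs)

context htqBa5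
begin

lemma iota5_closed: "a \<in> carr (alg5 H) \<Longrightarrow> iota5 H a \<in> carr (lat H)"
  using htqBa.H4_I_closed[OF htqBa] by simp

lemma gamma5_closed: "a \<in> carr (alg5 H) \<Longrightarrow> gamma5 H a \<in> carr (lat H)"
  using htqBa.H4_C_closed[OF htqBa] by simp

lemma emb_closed: "\<alpha> \<in> carr (lat H) \<Longrightarrow> emb H \<alpha> \<in> carr (alg5 H)"
  using H7_emb by (simp add: dma_hom_def blat_hom_def)

lemma clos_het_minus5: "a \<in> carr (alg5 H) \<Longrightarrow> \<C>\<^bsub>het_minus5 H\<^esub> a = emb H (gamma5 H a)"
  using clos_het_minus[OF htqBa] by (simp add: het_minus5_def)

lemma le_emb: "\<lbrakk>\<alpha> \<in> carr (lat H); \<beta> \<in> carr (lat H)\<rbrakk> \<Longrightarrow>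
    emb H \<alpha> \<sqsubseteq>\<^bsub>alg5 H\<^esub> emb H \<beta> \<longleftrightarrow> \<alpha> \<sqsubseteq>\<^bsub>lat H\<^esub> \<beta>"
  using H7_emb htqBa.H3_I(2)[OF htqBa]
  by (intro le_reflect[OF de_morgan_algebra.axioms(1)[OF H7_lat]]) (simp_all add: dma_hom_def)

text \<open>With one embedding \<open>e\<close> for both kernels, T5 is the retraction law \<open>\<gamma> (e \<alpha>) = \<alpha>\<close> at \<open>\<alpha> = \<iota> a\<close>.\<close>

lemma tqBa5_het_minus5: "tqBa5 (het_minus5 H)"
proof -
  interpret tqBa "het_minus5 H" unfolding het_minus5_def by (rule tqBa_het_minus[OF htqBa])
  show ?thesis
  proof
    fix a assume "a \<in> carr (het_minus5 H)"
    then have "iota5 H a \<in> carr (lat H)" by (simp add: het_minus5_def iota5_closed)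
    then show "\<C>\<^bsub>het_minus5 H\<^esub> (\<I>\<^bsub>het_minus5 H\<^esub> a) = \<I>\<^bsub>het_minus5 H\<^esub> a"
      using htqBa.H5_C_ret[OF htqBa] clos_het_minus5[OF emb_closed]
      by (simp add: het_minus5_def)
  qed
qed

end

theorem IA1_het_minus5:
  assumes "hIA1 H" shows "IA1 (het_minus5 H)"
proof -
  interpret hIA1 H by fact
  interpret tqBa5 "het_minus5 H" by (rule tqBa5_het_minus5)
  interpret L: boolean_dma "lat H" by (rule H8)
  note e = H7_emb[unfolded dma_hom_def blat_hom_def]
  show ?thesis
  proof
    fix a assume "a \<in> carr (het_minus5 H)"
    then have \<alpha>: "iota5 H a \<in> carr (lat H)" by (simp add: het_minus5_def iota5_closed)
    have "emb H (iota5 H a \<squnion>\<^bsub>lat H\<^esub> \<sim>\<^bsub>lat H\<^esub> (iota5 H a)) = \<top>\<^bsub>alg5 H\<^esub>"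
      using L.join_neg[OF \<alpha>] e by simp
    then show "\<I>\<^bsub>het_minus5 H\<^esub> a \<squnion>\<^bsub>het_minus5 H\<^esub> \<sim>\<^bsub>het_minus5 H\<^esub> (\<I>\<^bsub>het_minus5 H\<^esub> a)
        = \<top>\<^bsub>het_minus5 H\<^esub>"
      using e \<alpha> L.neg_closed[OF \<alpha>] by (simp add: het_minus5_def)
  qed
qed

theorem IA2_het_minus5:
  assumes "hIA2 H" shows "IA2 (het_minus5 H)"
proof -
  interpret hIA2 H by fact
  interpret tqBa5 "het_minus5 H" by (rule tqBa5_het_minus5)
  show ?thesis
    using H7_emb
    by unfold_locales (simp add: het_minus5_def H9 iota5_closed dma_hom_def blat_hom_def)
qed

theorem IA3_het_minus5:
  assumes "hIA3 H" shows "IA3 (het_minus5 H)"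
proof -
  interpret hIA3 H by fact
  interpret tqBa5 "het_minus5 H" by (rule tqBa5_het_minus5)
  show ?thesis
  proof
    fix a b
    assume "a \<in> carr (het_minus5 H)" "b \<in> carr (het_minus5 H)"
      "\<I>\<^bsub>het_minus5 H\<^esub> a \<sqsubseteq>\<^bsub>het_minus5 H\<^esub> \<I>\<^bsub>het_minus5 H\<^esub> b"
      "\<C>\<^bsub>het_minus5 H\<^esub> a \<sqsubseteq>\<^bsub>het_minus5 H\<^esub> \<C>\<^bsub>het_minus5 H\<^esub> b"
    then show "a \<sqsubseteq>\<^bsub>het_minus5 H\<^esub> b"
      using H10[of a b] clos_het_minus5[of a] clos_het_minus5[of b]
      by (simp add: het_minus5_def le_emb iota5_closed gamma5_closed)
  qed
qed

section \<open>The round trips\<close>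

lemma het_minus_tq_plus: "het_minus (tq_plus T) = T"
  by (simp add: het_minus_def tq_plus_def dma.defs tq.defs)

lemma het_minus5_tq_plus5: "het_minus5 (tq_plus5 T) = T"
  by (simp add: het_minus5_def het_of_tq_plus5 het_minus_def dma.defs tq.defs)

lemma tq_iso_refl: "tq_iso T T"
  unfolding tq_iso_def by (rule exI[of _ id]) (simp add: dma_hom_def blat_hom_def)

text \<open>
  By the retraction law the elements \<open>e\<^sub>I \<alpha>\<close> are exactly the values of \<open>e\<^sub>I \<circ> \<iota>\<close>, so \<open>e\<^sub>I\<close> is a
  bijection onto the left kernel. It respects the operations because \<open>e\<^sub>I \<circ> \<iota>\<close>, which the kernel
  operations apply to every result, fixes \<open>e\<^sub>I (\<alpha> \<union> \<beta>)\<close> and \<open>e\<^sub>I (\<alpha> \<inter> \<beta>)\<close>. The right kernel is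
  treated alike, with \<open>e\<^sub>C \<circ> \<gamma>\<close> as the derived closure.
\<close>

theorem het_iso_round_trip:
  assumes "htqBa H" shows "het_iso H (tq_plus (het_minus H))"
proof -
  interpret htqBa H by fact
  interpret M: tqBa "het_minus H" by (rule tqBa_het_minus[OF assms])
  have D: "tq_plus (het_minus H) = \<lparr>alg = alg H, lat_I = left_kernel (het_minus H),
     lat_C = right_kernel (het_minus H), emb_I = id, emb_C = id,
     iota = \<I>\<^bsub>het_minus H\<^esub>, gamma = \<C>\<^bsub>het_minus H\<^esub>\<rparr>"
    by (simp add: tq_plus_def)
  note e = H3_I(1)[unfolded blat_hom_def] and e' = H3_C(1)[unfolded blat_hom_def]
  note c = clos_het_minus[OF assms]
  interpret I: bounded_dlattice "lat_I H" by (rule H2_I)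
  interpret C: bounded_dlattice "lat_C H" by (rule H2_C)
  have fixI: "emb_I H (iota H (emb_I H \<alpha>)) = emb_I H \<alpha>" if "\<alpha> \<in> carr (lat_I H)" for \<alpha>
    using that by (simp add: H5_I_ret)
  have fixC: "\<C>\<^bsub>het_minus H\<^esub> (emb_C H \<xi>) = emb_C H \<xi>" if "\<xi> \<in> carr (lat_C H)" for \<xi>
    using that e' by (simp add: c H5_C_ret)
  have imI: "emb_I H ` carr (lat_I H) = carr (left_kernel (het_minus H))"
    using e H4_I_closed fixI by (force simp: left_kernel_def)
  have imC: "emb_C H ` carr (lat_C H) = carr (right_kernel (het_minus H))"
    using e' H4_C_closed fixC c by (force simp: right_kernel_def)
  have homI: "blat_hom (lat_I H) (left_kernel (het_minus H)) (emb_I H)"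
    unfolding blat_hom_def
  proof (intro conjI ballI)
    fix x assume "x \<in> carr (lat_I H)"
    then show "emb_I H x \<in> carr (left_kernel (het_minus H))" using imI by blast
  qed (use e fixI in \<open>simp_all add: left_kernel_def H4_I_top H4_I_bot,
      metis I.join_closed, metis I.meet_closed\<close>)
  have homC: "blat_hom (lat_C H) (right_kernel (het_minus H)) (emb_C H)"
    unfolding blat_hom_def
  proof (intro conjI ballI)
    fix x assume "x \<in> carr (lat_C H)"
    then show "emb_C H x \<in> carr (right_kernel (het_minus H))" using imC by blast
  qed (use e' fixC M.clos_top M.clos_bot in \<open>simp_all add: right_kernel_def,
      metis C.join_closed, metis C.meet_closed\<close>)
  show ?thesis
    unfolding het_iso_def D het.simps
    using H3_I(2) H3_C(2) imI imC homI homC c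
    by (intro exI[of _ id] exI[of _ "emb_I H"] exI[of _ "emb_C H"])
      (simp add: bij_betw_def dma_hom_def blat_hom_def)
qed

text \<open>
  The isomorphism is again the embedding, which now also has to carry the negation of the lattice
  to the kernel negation.
\<close>

theorem het5_iso_round_trip:
  assumes "htqBa5 H" shows "het5_iso H (tq_plus5 (het_minus5 H))"
proof -
  interpret htqBa5 H by fact
  interpret h: htqBa "het_of H" by (rule htqBa)
  interpret M: tqBa5 "het_minus5 H" by (rule tqBa5_het_minus5)
  interpret L: de_morgan_algebra "lat H" by (rule H7_lat)
  note e = H7_emb[unfolded dma_hom_def blat_hom_def]
  have D: "tq_plus5 (het_minus5 H) = \<lparr>alg5 = alg5 H, lat = kernel5 (het_minus5 H), emb = id,
    iota5 = \<I>\<^bsub>het_minus5 H\<^esub>, gamma5 = \<C>\<^bsub>het_minus5 H\<^esub>\<rparr>"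
    by (simp add: tq_plus5_def het_minus5_def)
  have fix_emb: "emb H (iota5 H (emb H \<alpha>)) = emb H \<alpha>" if "\<alpha> \<in> carr (lat H)" for \<alpha>
    using that h.H5_I_ret by simp
  have im: "emb H ` carr (lat H) = carr (kernel5 (het_minus5 H))"
    using e iota5_closed fix_emb by (force simp: het_minus5_def)
  have hom: "dma_hom (lat H) (kernel5 (het_minus5 H)) (emb H)"
    unfolding dma_hom_def blat_hom_def
  proof (intro conjI ballI)
    fix x assume "x \<in> carr (lat H)"
    then show "emb H x \<in> carr (kernel5 (het_minus5 H))" using im by blast
  qed (use e fix_emb in \<open>simp_all add: het_minus5_def, metis L.join_closed, metis L.meet_closed,
      metis L.top_closed, metis L.bot_closed, metis L.neg_closed\<close>)
  show ?thesis
    unfolding het5_iso_def D het5.simps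
    using h.H3_I(2) im hom clos_het_minus5
    by (intro exI[of _ id] exI[of _ "emb H"])
      (simp add: bij_betw_def dma_hom_def blat_hom_def het_minus5_def)
qed

theorem proposition3:
  shows
    "((\<forall>T :: 'a tq. tqBa T \<longrightarrow> htqBa (tq_plus T)) \<and>
      (\<forall>H :: ('d, 'i, 'c) het. htqBa H \<longrightarrow> tqBa (het_minus H)) \<and>
      (\<forall>T :: 'a tq. tqBa T \<longrightarrow> tq_iso T (het_minus (tq_plus T))) \<and>
      (\<forall>H :: ('d, 'i, 'c) het. htqBa H \<longrightarrow> het_iso H (tq_plus (het_minus H)))) \<and>
     ((\<forall>T :: 'a tq. tqBa5 T \<longrightarrow> htqBa5 (tq_plus5 T)) \<and>
      (\<forall>H :: ('d, 'l) het5. htqBa5 H \<longrightarrow> tqBa5 (het_minus5 H)) \<and>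
      (\<forall>T :: 'a tq. tqBa5 T \<longrightarrow> tq_iso T (het_minus5 (tq_plus5 T))) \<and>
      (\<forall>H :: ('d, 'l) het5. htqBa5 H \<longrightarrow> het5_iso H (tq_plus5 (het_minus5 H)))) \<and>
     ((\<forall>T :: 'a tq. IA1 T \<longrightarrow> hIA1 (tq_plus5 T)) \<and>
      (\<forall>H :: ('d, 'l) het5. hIA1 H \<longrightarrow> IA1 (het_minus5 H)) \<and>
      (\<forall>T :: 'a tq. IA1 T \<longrightarrow> tq_iso T (het_minus5 (tq_plus5 T))) \<and>
      (\<forall>H :: ('d, 'l) het5. hIA1 H \<longrightarrow> het5_iso H (tq_plus5 (het_minus5 H)))) \<and>
     ((\<forall>T :: 'a tq. IA2 T \<longrightarrow> hIA2 (tq_plus5 T)) \<and>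
      (\<forall>H :: ('d, 'l) het5. hIA2 H \<longrightarrow> IA2 (het_minus5 H)) \<and>
      (\<forall>T :: 'a tq. IA2 T \<longrightarrow> tq_iso T (het_minus5 (tq_plus5 T))) \<and>
      (\<forall>H :: ('d, 'l) het5. hIA2 H \<longrightarrow> het5_iso H (tq_plus5 (het_minus5 H)))) \<and>
     ((\<forall>T :: 'a tq. IA3 T \<longrightarrow> hIA3 (tq_plus5 T)) \<and>
      (\<forall>H :: ('d, 'l) het5. hIA3 H \<longrightarrow> IA3 (het_minus5 H)) \<and>
      (\<forall>T :: 'a tq. IA3 T \<longrightarrow> tq_iso T (het_minus5 (tq_plus5 T))) \<and>
      (\<forall>H :: ('d, 'l) het5. hIA3 H \<longrightarrow> het5_iso H (tq_plus5 (het_minus5 H)))) \<and>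
     ((\<forall>T :: 'a tq. pra T \<longrightarrow> hpra (tq_plus5 T)) \<and>
      (\<forall>H :: ('d, 'l) het5. hpra H \<longrightarrow> pra (het_minus5 H)) \<and>
      (\<forall>T :: 'a tq. pra T \<longrightarrow> tq_iso T (het_minus5 (tq_plus5 T))) \<and>
      (\<forall>H :: ('d, 'l) het5. hpra H \<longrightarrow> het5_iso H (tq_plus5 (het_minus5 H))))"
proof -
  have pra1: "hpra (tq_plus5 T)" if "pra T" for T :: "'a tq"
    using that by (simp add: pra_def hpra_def hIA1_tq_plus5 hIA2_tq_plus5 hIA3_tq_plus5)
  have pra2: "pra (het_minus5 H)" if "hpra H" for H :: "('d, 'l) het5"
    using that by (simp add: pra_def hpra_def IA1_het_minus5 IA2_het_minus5 IA3_het_minus5)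
  have sub: "hIA1 H \<Longrightarrow> htqBa5 H" "hIA2 H \<Longrightarrow> htqBa5 H" "hIA3 H \<Longrightarrow> htqBa5 H" "hpra H \<Longrightarrow> htqBa5 H"
    for H :: "('d, 'l) het5"
    by (auto simp: hIA1_def hIA2_def hIA3_def hpra_def)
  show ?thesis
    using sub
    by (simp add: htqBa_tq_plus htqBa5_tq_plus5 hIA1_tq_plus5 hIA2_tq_plus5 hIA3_tq_plus5 pra1
        tqBa_het_minus htqBa5.tqBa5_het_minus5 IA1_het_minus5 IA2_het_minus5 IA3_het_minus5 pra2
        het_minus_tq_plus het_minus5_tq_plus5 tq_iso_refl het_iso_round_trip het5_iso_round_trip)
qed

end
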